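(* Consider continuous 3-player Guts with players 2 and 3 restricted to bloc strategies $p_2^*=p_3^*$. Then $p_1^*=1/\sqrt2$ is optimal for player 1, guaranteeing nonnegative return, with $$\alpha(1/\sqrt2,p_2^*,p_2^* )\ge 4\big(p_2^*-1/\sqrt2\big)^2\big(p_2^*+1/\sqrt2\big)\quad\text{for } p_2^*\ge 1/\sqrt2,$$ $$\alpha(1/\sqrt2,p_2^*,p_2^* )\ge 2\big(p_2^*-1/\sqrt2\big)^2/\sqrt2\quad\text{for } p_2^*\le 1/\sqrt2 .$$ Likewise, $p_2^*=p_3^*=1/\sqrt2$ is optimal for players 2-3, guaranteeing nonpositive return to player 1.
   Context: Continuous 3-player Guts: players 1, 2, 3 receive independent hands $p_1,p_2,p_3$ uniform on $[0,1]$. A pure strategy of player $i$ is a threshold $p_i^*\in[0,1]$: hold if $p_i\ge p_i^*$, drop if $p_i<p_i^*$. Each ante is one unit, so the pot is $3$. Let $r$ be the number of holding players. If $r=0$, the immediate return to each player is $0$ and the game is replayed with stakes factor $1$. If $r\ge1$, the stakes factor for the replay is $r-1$ (factor $0$ means the game ends) and a player's immediate return is $(r-2)+3$ if the player holds and has the highest hand among holders, $(r-2)-3$ if the player holds but does not have the highest hand, and $r-2$ if the player drops. $\alpha(p_1^*,p_2^*,p_3^* )$ is the expected immediate return to player 1, $\beta(p_1^*,p_2^*,p_3^* )$ the expected stakes factor; both are extended to mixed strategies by averaging. Total return in the bloc game: early exit costs a fee of $1$ times current stakes. For a sequence $S=(\mu_1,\mu_2,\dots)$ of mixed strategies (probability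 measures on $[0,1]$) of player 1, put $G_{n+1}=-1$, $G_k=\inf_{q\in[0,1]}[\alpha(\mu_k,q,q)+\beta(\mu_k,q,q)G_{k+1}]$ and $g_n(S)=G_1$; $S$ guarantees return at least $c$ if $\sup_n g_n(S)\ge c$. For a sequence $Q=(\nu_1,\nu_2,\dots)$ of probability measures on bloc strategies $(q,q)$, put $H_{n+1}=+1$, $H_k=\sup_{p\in[0,1]}\int[\alpha(p,q,q)+\beta(p,q,q)H_{k+1}]\,d\nu_k(q)$ and $h_n(Q)=H_1$; $Q$ guarantees that player 1's return is at most $c$ if $\inf_n h_n(Q)\le c$. A single-stage strategy is identified with the sequence repeating it every round. "Optimal" means that no strategy sequence of the same side gives a better guarantee. *)

theory Defs
  imports "HOL-Probability.Probability"
begin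

section \<open>Continuous 3-player Guts\<close>

definition players :: "nat set" where
  "players = {1, 2, 3}"

definition hands :: "(nat \<Rightarrow> real) measure" where
  "hands = PiM players (\<lambda>_. uniform_measure lborel {0..1})"

definition holders :: "(nat \<Rightarrow> real) \<Rightarrow> (nat \<Rightarrow> real) \<Rightarrow> nat set" where
  "holders t h = {i \<in> players. t i \<le> h i}"

definition stakes_factor :: "(nat \<Rightarrow> real) \<Rightarrow> (nat \<Rightarrow> real) \<Rightarrow> real" where
  "stakes_factor t h =
     (let r = card (holders t h) in if r = 0 then 1 else real r - 1)"

text \<open>Ties for the highest hand, which form a null set, count as wins for every tied player.\<close>

definition immediate_return :: "(nat \<Rightarrow> real) \<Rightarrow> nat \<Rightarrow> (nat \<Rightarrow> real) \<Rightarrow> real" where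
  "immediate_return t i h =
     (let H = holders t h; r = card H in
        if r = 0 then 0
        else if i \<notin> H then real r - 2
        else if \<forall>j\<in>H. h j \<le> h i then (real r - 2) + 3
        else (real r - 2) - 3)"

definition thresholds :: "real \<Rightarrow> real \<Rightarrow> real \<Rightarrow> nat \<Rightarrow> real" where
  "thresholds p1 p2 p3 = (\<lambda>i. if i = 1 then p1 else if i = 2 then p2 else p3)"

definition alpha :: "real \<Rightarrow> real \<Rightarrow> real \<Rightarrow> real" where
  "alpha p1 p2 p3 = (\<integral>h. immediate_return (thresholds p1 p2 p3) 1 h \<partial>hands)"

definition beta :: "real \<Rightarrow> real \<Rightarrow> real \<Rightarrow> real" where
  "beta p1 p2 p3 = (\<integral>h. stakes_factor (thresholds p1 p2 p3) h \<partial>hands)"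

section \<open>Strategies in the bloc game\<close>

text \<open>A mixed strategy is a probability measure on [0,1], represented as a Borel measure on the
  reals concentrated on [0,1]. For players 2 and 3 it is the distribution of the common
  threshold q of the bloc strategy (q,q).\<close>

definition mixed_strategy :: "real measure \<Rightarrow> bool" where
  "mixed_strategy \<mu> \<longleftrightarrow> prob_space \<mu> \<and> sets \<mu> = sets borel \<and> emeasure \<mu> {0..1} = 1"

text \<open>Sequences are indexed from 0: S k is the mixed strategy played in round k + 1.\<close>

type_synonym strategy_seq = "nat \<Rightarrow> real measure"

definition strategy_sequence :: "strategy_seq \<Rightarrow> bool" where
  "strategy_sequence S \<longleftrightarrow> (\<forall>k. mixed_strategy (S k))"

definition pure :: "real \<Rightarrow> real measure" where
  "pure p = return borel p"

definition repeated :: "real measure \<Rightarrow> strategy_seq" where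
  "repeated \<mu> = (\<lambda>_. \<mu>)"

definition alpha_mixed :: "real measure \<Rightarrow> real \<Rightarrow> real \<Rightarrow> real" where
  "alpha_mixed \<mu> p2 p3 = (\<integral>p. alpha p p2 p3 \<partial>\<mu>)"

definition beta_mixed :: "real measure \<Rightarrow> real \<Rightarrow> real \<Rightarrow> real" where
  "beta_mixed \<mu> p2 p3 = (\<integral>p. beta p p2 p3 \<partial>\<mu>)"

section \<open>Guarantees with early exit\<close>

text \<open>The first numerical argument is the number of rounds left before the early exit, the
  second the index of the current round; backward induction over n rounds is thus recursion on
  the former.\<close>

primrec worst_return :: "strategy_seq \<Rightarrow> nat \<Rightarrow> nat \<Rightarrow> real" where
  "worst_return S 0 k = -1"
| "worst_return S (Suc m) k =
     (INF q\<in>{0..1}. alpha_mixed (S k) q q + beta_mixed (S k) q q * worst_return S m (Suc k))"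

primrec best_return :: "strategy_seq \<Rightarrow> nat \<Rightarrow> nat \<Rightarrow> real" where
  "best_return Q 0 k = 1"
| "best_return Q (Suc m) k =
     (SUP p\<in>{0..1}. \<integral>q. (alpha p q q + beta p q q * best_return Q m (Suc k)) \<partial>(Q k))"

definition player1_value :: "nat \<Rightarrow> strategy_seq \<Rightarrow> real" where
  "player1_value n S = worst_return S n 0"

definition bloc_value :: "nat \<Rightarrow> strategy_seq \<Rightarrow> real" where
  "bloc_value n Q = best_return Q n 0"

text \<open>The supremum and infimum over n are taken in the extended reals, so that they are
  meaningful without a boundedness condition.\<close>

definition guarantees_at_least :: "strategy_seq \<Rightarrow> real \<Rightarrow> bool" where
  "guarantees_at_least S c \<longleftrightarrow> (SUP n\<in>{1..}. ereal (player1_value n S)) \<ge> ereal c"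

definition guarantees_at_most :: "strategy_seq \<Rightarrow> real \<Rightarrow> bool" where
  "guarantees_at_most Q c \<longleftrightarrow> (INF n\<in>{1..}. ereal (bloc_value n Q)) \<le> ereal c"

definition optimal_player1 :: "strategy_seq \<Rightarrow> bool" where
  "optimal_player1 S \<longleftrightarrow> strategy_sequence S \<and>
     (\<forall>S' c. strategy_sequence S' \<longrightarrow> guarantees_at_least S' c \<longrightarrow> guarantees_at_least S c)"

definition optimal_bloc :: "strategy_seq \<Rightarrow> bool" where
  "optimal_bloc Q \<longleftrightarrow> strategy_sequence Q \<and>
     (\<forall>Q' c. strategy_sequence Q' \<longrightarrow> guarantees_at_most Q' c \<longrightarrow> guarantees_at_most Q c)"

end

theory Submission
  imports Defs
begin

text \<open>
  Write \<open>c\<close> for \<open>1 / sqrt 2\<close>. The pair of thresholds \<open>p = c\<close>, \<open>q = c\<close> is a saddle point of the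
  single-round return \<open>alpha p q q\<close>, with value \<open>0\<close>: the return vanishes there, is nonpositive for
  \<open>q = c\<close> and every \<open>p\<close>, and nonnegative for \<open>p = c\<close> and every \<open>q\<close>. This is visible from a closed
  form. Player 1's return is the stakes factor minus \<open>1\<close>, corrected by \<open>\<plusminus>3\<close> when player 1 holds, so
  its expectation needs only the probabilities that a player holds, that all drop, and that player 1
  holds and wins. Given player 1's hand \<open>x\<close>, the two opponents independently fail to beat \<open>x\<close> with
  probability \<open>max q x\<close> each, so the last probability is the integral of \<open>(max q x)\<^sup>2\<close> over
  \<open>{p..1}\<close>. Hence \<open>alpha p q q = 2 (p - q) (1 - p (p + q))\<close> for \<open>q \<le> p\<close> and
  \<open>(q - p) (4 q\<^sup>2 - 2)\<close> for \<open>p \<le> q\<close>, while \<open>beta p q q = 2 - p - 2 q + 2 p q\<^sup>2\<close>.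

  That no sequence does better than \<open>0\<close> follows by backward induction: against any strategy of the
  other side, answering with \<open>c\<close> in every round keeps the value on the right side of \<open>0\<close>, because
  the exit fee has that sign and the stakes factor is nonnegative (\<open>worst_return_nonpos\<close>,
  \<open>best_return_nonneg\<close>).

  That \<open>c\<close> does achieve \<open>0\<close> needs the stakes to shrink, although \<open>beta c q q\<close> exceeds \<open>1\<close> for
  small \<open>q\<close>. The remedy is an exact compensation: \<open>beta c q q = (2 - 2 c) + 2 c (q - c)\<^sup>2\<close>, whereas
  \<open>alpha c q q \<ge> 2 c (q - c)\<^sup>2\<close>. A deviation of the bloc that raises the stakes therefore pays
  player 1 at least as much as the additional stakes can cost, as long as the continuation value is
  at least \<open>-1\<close>. So every round multiplies the outstanding fee by at most \<open>2 - 2 c < 1\<close>, and over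
  \<open>n\<close> rounds the loss is at most \<open>(2 - 2 c) ^ n\<close> (\<open>worst_return_crit\<close>). When the bloc plays \<open>c\<close>,
  the stakes factor equals \<open>2 - 2 c\<close> whatever player 1 does, which gives the other guarantee
  (\<open>best_return_crit\<close>).
\<close>
section \<open>Returns and stakes as sums of indicators\<close>

lemma card_holders:
  "real (card (holders t h)) = (\<Sum>i\<in>players. of_bool (t i \<le> h i))"
proof -
  have "(\<Sum>i\<in>players. of_bool (t i \<le> h i) :: real) = (\<Sum>i\<in>players. if t i \<le> h i then 1 else 0)"
    by (rule sum.cong) auto
  also have "\<dots> = real (card (holders t h))"
    by (simp add: holders_def players_def flip: sum.inter_filter)
  finally show ?thesis ..
qed

lemma holders_empty_iff:
  "card (holders t h) = 0 \<longleftrightarrow> (\<forall>i\<in>players. h i < t i)"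
  by (auto simp: holders_def players_def not_le)

definition drop_event :: "(nat \<Rightarrow> real) \<Rightarrow> (nat \<Rightarrow> real) set" where
  "drop_event t = {h \<in> space hands. \<forall>i\<in>players. h i < t i}"

definition hold_event :: "(nat \<Rightarrow> real) \<Rightarrow> nat \<Rightarrow> (nat \<Rightarrow> real) set" where
  "hold_event t i = {h \<in> space hands. t i \<le> h i}"

text \<open>For \<open>j = i\<close> the second condition is trivially true. The weak inequality follows the convention
  that every tied player wins.\<close>
definition win_event :: "(nat \<Rightarrow> real) \<Rightarrow> nat \<Rightarrow> (nat \<Rightarrow> real) set" where
  "win_event t i = {h \<in> space hands. t i \<le> h i \<and> (\<forall>j\<in>players. h j < t j \<or> h j \<le> h i)}"

lemma stakes_factor_indicator:
  assumes "h \<in> space hands"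
  shows "stakes_factor t h
    = (\<Sum>i\<in>players. indicator (hold_event t i) h) - 1 + 2 * indicator (drop_event t) h"
  using assms card_holders[of t h] holders_empty_iff[of t h]
  by (auto simp: stakes_factor_def Let_def hold_event_def drop_event_def indicator_def of_bool_def)

text \<open>A holder who wins gets \<open>(r - 2) + 3\<close>, one who loses \<open>(r - 2) - 3\<close>, and \<open>r - 2\<close> is the stakes
  factor minus \<open>1\<close>. If all drop, the stakes factor is \<open>1\<close> rather than \<open>-1\<close>, so that the formula
  gives the return \<open>0\<close> in this case as well.\<close>
lemma immediate_return_indicator:
  assumes "h \<in> space hands" "i \<in> players"
  shows "immediate_return t i h
    = stakes_factor t h - 1 + 6 * indicator (win_event t i) h - 3 * indicator (hold_event t i) h"
proof (cases "t i \<le> h i")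
  case True
  then have "card (holders t h) \<noteq> 0"
    using assms by (auto simp: holders_empty_iff not_less)
  moreover have "(\<forall>j\<in>holders t h. h j \<le> h i)
      \<longleftrightarrow> (\<forall>j\<in>players. h j < t j \<or> h j \<le> h i)"
    by (simp add: holders_def) (meson not_le)
  ultimately show ?thesis
    using True assms
    by (auto simp: immediate_return_def stakes_factor_def Let_def win_event_def hold_event_def
        holders_def)
next
  case False
  then show ?thesis
    using assms
    by (auto simp: immediate_return_def stakes_factor_def Let_def win_event_def hold_event_def holders_def)
qed

section \<open>Expected return and expected stakes factor\<close>

abbreviation hand :: "real measure" where
  "hand \<equiv> uniform_measure lborel {0..1}"

lemma prob_space_hand: "prob_space hand"
  by (rule prob_space_uniform_measure) auto

interpretation hand: product_prob_space "\<lambda>_::nat. hand" I for I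
  by (intro product_prob_spaceI prob_space_hand)

interpretation hands: finite_product_prob_space "\<lambda>_. hand" players
  by unfold_locales (simp add: players_def)

lemma hands_eq_PiM: "hands = PiM players (\<lambda>_. hand)"
  by (simp add: hands_def)

lemma space_hands: "space hands = PiE players (\<lambda>_. UNIV)"
  by (simp add: hands_eq_PiM space_PiM)

lemma prob_space_hands: "prob_space hands"
  unfolding hands_eq_PiM by (rule prob_space_PiM) (rule prob_space_hand)

lemma measurable_hands_component [measurable]:
  assumes "i \<in> players"
  shows "(\<lambda>h. h i) \<in> borel_measurable hands"
proof -
  have "(\<lambda>h. h i) \<in> measurable (PiM players (\<lambda>_. hand)) hand"
    using assms by (rule measurable_component_singleton)
  moreover have "measurable (PiM players (\<lambda>_. hand)) hand = borel_measurable hands"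
    by (rule measurable_cong_sets) (simp_all add: hands_eq_PiM)
  ultimately show ?thesis by simp
qed

lemma finite_players [simp]: "finite players"
  by (simp add: players_def)

lemma sets_hold_event [measurable]: "i \<in> players \<Longrightarrow> hold_event t i \<in> sets hands"
  unfolding hold_event_def by measurable

lemma sets_drop_event [measurable]: "drop_event t \<in> sets hands"
  unfolding drop_event_def by measurable

lemma sets_win_event [measurable]:
  assumes [measurable]: "i \<in> players"
  shows "win_event t i \<in> sets hands"
proof -
  have [measurable]: "Measurable.pred hands (\<lambda>h. h j \<le> h i)" if "j \<in> players" for j
    unfolding pred_def using assms that
    by (intro borel_measurable_le measurable_hands_component)
  show ?thesis
    unfolding win_event_def by measurable
qed

lemma prob_hand_lessThan: "t \<in> {0..1} \<Longrightarrow> measure hand {..<t} = t"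
proof -
  assume "t \<in> {0..1}"
  then have "{0..1} \<inter> {..<t} = {0..<t}" by auto
  then show ?thesis using \<open>t \<in> {0..1}\<close> by simp
qed

lemma prob_hand_atLeast: "t \<in> {0..1} \<Longrightarrow> measure hand {t..} = 1 - t"
proof -
  assume "t \<in> {0..1}"
  then have "{0..1} \<inter> {t..} = {t..1}" by auto
  then show ?thesis using \<open>t \<in> {0..1}\<close> by simp
qed

lemma prob_hand_beaten:
  assumes "t \<in> {0..1}" "x \<in> {0..1}"
  shows "measure hand ({..<t} \<union> {..x}) = max t x"
proof (cases "t \<le> x")
  case True
  then have "{0..1} \<inter> ({..<t} \<union> {..x}) = {0..x}" using assms by auto
  then show ?thesis using True assms by simp
next
  case False
  then have "{0..1} \<inter> ({..<t} \<union> {..x}) = {0..<t}" using assms by auto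
  then show ?thesis using False assms by simp
qed

lemma prob_drop_event:
  assumes "\<And>i. i \<in> players \<Longrightarrow> t i \<in> {0..1}"
  shows "measure hands (drop_event t) = (\<Prod>i\<in>players. t i)"
proof -
  have "drop_event t = PiE players (\<lambda>i. {..<t i})"
    by (auto simp: drop_event_def space_hands PiE_def Pi_def)
  then show ?thesis
    using assms by (simp add: hands_eq_PiM hands.prob_times prob_hand_lessThan
        del: measure_uniform_measure)
qed

lemma prob_hold_event:
  assumes "i \<in> players" "t i \<in> {0..1}"
  shows "measure hands (hold_event t i) = 1 - t i"
proof -
  have "hold_event t i = PiE players (\<lambda>j. if j = i then {t i..} else UNIV)"
    using assms by (auto simp: hold_event_def space_hands PiE_def Pi_def)
  then have "measure hands (hold_event t i)
      = (\<Prod>j\<in>players. measure hand (if j = i then {t i..} else UNIV))"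
    by (simp add: hands_eq_PiM hands.prob_times del: measure_uniform_measure)
  also have "\<dots> = (\<Prod>j\<in>players. if j = i then 1 - t i else 1)"
    using assms prob_space.prob_space[OF prob_space_hand]
    by (intro prod.cong) (auto simp: prob_hand_atLeast simp del: measure_uniform_measure)
  finally show ?thesis using assms by simp
qed

text \<open>Condition on the hand \<open>x\<close> of player \<open>i\<close>. Each opponent \<open>j\<close> fails to beat it by dropping or by
  holding a hand of at most \<open>x\<close>, an event of probability \<open>max (t j) x\<close>, and the opponents' hands are
  independent.\<close>
lemma prob_win_event:
  assumes i: "i \<in> players" and t: "\<And>j. j \<in> players \<Longrightarrow> t j \<in> {0..1}"
  shows "measure hands (win_event t i)
    = (\<integral>x. indicator {t i..1} x * (\<Prod>j\<in>players - {i}. max (t j) x) \<partial>lborel)"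
proof -
  let ?J = "players - {i}"
  have players: "players = insert i ?J" using i by auto
  have meas: "(\<lambda>h. indicator (win_event t i) h :: ennreal) \<in> borel_measurable (PiM (insert i ?J) (\<lambda>_. hand))"
    using i by (subst players[symmetric], subst hands_eq_PiM[symmetric]) measurable
  have inner: "(\<integral>\<^sup>+h. indicator (win_event t i) (h(i := x)) \<partial>PiM ?J (\<lambda>_. hand))
      = ennreal (indicator {t i..} x * (\<Prod>j\<in>?J. max (t j) x))" if x: "x \<in> {0..1}" for x
  proof -
    interpret J: finite_product_prob_space "\<lambda>_. hand" ?J
      by unfold_locales simp
    let ?B = "PiE ?J (\<lambda>j. {..<t j} \<union> {..x})"
    have B: "?B \<in> sets (PiM ?J (\<lambda>_. hand))"
      by (intro sets_PiM_I_finite) auto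
    have "(\<integral>\<^sup>+h. indicator (win_event t i) (h(i := x)) \<partial>PiM ?J (\<lambda>_. hand))
        = (\<integral>\<^sup>+h. indicator {t i..} x * indicator ?B h \<partial>PiM ?J (\<lambda>_. hand))"
    proof (intro nn_integral_cong)
      fix h assume "h \<in> space (PiM ?J (\<lambda>_. hand))"
      then have "h(i := x) \<in> space hands" "h \<in> extensional ?J"
        using i by (auto simp: space_hands space_PiM PiE_iff extensional_def)
      then have "h(i := x) \<in> win_event t i \<longleftrightarrow> x \<in> {t i..} \<and> h \<in> ?B"
        using i by (auto simp: win_event_def PiE_def Pi_def)
      then show "indicator (win_event t i) (h(i := x)) = (indicator {t i..} x * indicator ?B h :: ennreal)"
        by (simp add: indicator_def)
    qed
    also have "\<dots> = indicator {t i..} x * emeasure (PiM ?J (\<lambda>_. hand)) ?B"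
      using B by (rule nn_integral_cmult_indicator)
    also have "emeasure (PiM ?J (\<lambda>_. hand)) ?B = ennreal (\<Prod>j\<in>?J. max (t j) x)"
      using t x by (simp add: hand.P.emeasure_eq_measure J.prob_times prob_hand_beaten
          del: measure_uniform_measure)
    also have "indicator {t i..} x * ennreal (\<Prod>j\<in>?J. max (t j) x)
        = ennreal (indicator {t i..} x * (\<Prod>j\<in>?J. max (t j) x))"
      by (cases "t i \<le> x") auto
    finally show ?thesis .
  qed
  have "emeasure hands (win_event t i) = (\<integral>\<^sup>+h. indicator (win_event t i) h \<partial>hands)"
    using i by simp
  also have "\<dots> = (\<integral>\<^sup>+h. indicator (win_event t i) h \<partial>PiM (insert i ?J) (\<lambda>_. hand))"
    by (simp only: hands_eq_PiM flip: players)
  also have "\<dots> = (\<integral>\<^sup>+x. \<integral>\<^sup>+h. indicator (win_event t i) (h(i := x)) \<partial>PiM ?J (\<lambda>_. hand) \<partial>hand)"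
    using meas by (intro hand.product_nn_integral_insert_rev) auto
  also have "\<dots> = (\<integral>\<^sup>+x. ennreal (indicator {t i..} x * (\<Prod>j\<in>?J. max (t j) x)) \<partial>hand)"
    by (intro nn_integral_cong_AE AE_uniform_measureI) (auto simp: inner)
  also have "\<dots> = (\<integral>\<^sup>+x. ennreal (indicator {t i..} x * (\<Prod>j\<in>?J. max (t j) x))
      * indicator {0..1} x \<partial>lborel)"
    by (simp add: nn_integral_uniform_measure divide_ennreal_def)
  also have "\<dots> = (\<integral>\<^sup>+x. ennreal (indicator {t i..1} x * (\<Prod>j\<in>?J. max (t j) x)) \<partial>lborel)"
    using t[OF i] by (intro nn_integral_cong) (auto simp: indicator_def)
  finally have "emeasure hands (win_event t i) = \<dots>" .
  then show ?thesis
    using t i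
    by (subst integral_eq_nn_integral)
      (auto simp: measure_def indicator_def intro!: prod_nonneg AE_I2 max.coboundedI1)
qed

lemma has_bochner_integral_stakes_factor:
  assumes "\<And>i. i \<in> players \<Longrightarrow> t i \<in> {0..1}"
  shows "has_bochner_integral hands (stakes_factor t)
    (2 - (\<Sum>i\<in>players. t i) + 2 * (\<Prod>i\<in>players. t i))"
proof -
  interpret H: prob_space hands by (rule prob_space_hands)
  have "has_bochner_integral hands
      (\<lambda>h. (\<Sum>i\<in>players. indicator (hold_event t i) h) - 1 + 2 * indicator (drop_event t) h)
      ((\<Sum>i\<in>players. measure hands (hold_event t i)) - 1 + 2 * measure hands (drop_event t))"
    by (intro has_bochner_integral_add has_bochner_integral_diff has_bochner_integral_sum
        has_bochner_integral_mult_right has_bochner_integral_real_indicator)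
      (auto simp: H.emeasure_eq_measure has_bochner_integral_iff H.prob_space)
  also have "(\<Sum>i\<in>players. measure hands (hold_event t i)) = (\<Sum>i\<in>players. 1 - t i)"
    using assms by (intro sum.cong) (auto simp: prob_hold_event)
  also have "\<dots> = 3 - (\<Sum>i\<in>players. t i)"
    by (simp add: players_def)
  also have "measure hands (drop_event t) = (\<Prod>i\<in>players. t i)"
    using assms by (rule prob_drop_event)
  also have "has_bochner_integral hands
      (\<lambda>h. (\<Sum>i\<in>players. indicator (hold_event t i) h) - 1 + 2 * indicator (drop_event t) h) x
      \<longleftrightarrow> has_bochner_integral hands (stakes_factor t) x" for x
    by (intro has_bochner_integral_cong refl stakes_factor_indicator[symmetric])
  finally show ?thesis by simp
qed

lemma has_bochner_integral_immediate_return: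
  assumes t: "\<And>i. i \<in> players \<Longrightarrow> t i \<in> {0..1}" and i: "i \<in> players"
  shows "has_bochner_integral hands (immediate_return t i)
    (2 - (\<Sum>i\<in>players. t i) + 2 * (\<Prod>i\<in>players. t i) - 1
      + 6 * (\<integral>x. indicator {t i..1} x * (\<Prod>j\<in>players - {i}. max (t j) x) \<partial>lborel)
      - 3 * (1 - t i))"
proof -
  interpret H: prob_space hands by (rule prob_space_hands)
  have "has_bochner_integral hands
      (\<lambda>h. stakes_factor t h - 1 + 6 * indicator (win_event t i) h - 3 * indicator (hold_event t i) h)
      ((2 - (\<Sum>i\<in>players. t i) + 2 * (\<Prod>i\<in>players. t i)) - 1
        + 6 * measure hands (win_event t i) - 3 * measure hands (hold_event t i))"
    using i
    by (intro has_bochner_integral_add has_bochner_integral_diff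
        has_bochner_integral_stakes_factor t
        has_bochner_integral_mult_right has_bochner_integral_real_indicator)
      (auto simp: H.emeasure_eq_measure has_bochner_integral_iff H.prob_space)
  also have "has_bochner_integral hands
      (\<lambda>h. stakes_factor t h - 1 + 6 * indicator (win_event t i) h - 3 * indicator (hold_event t i) h) x
      \<longleftrightarrow> has_bochner_integral hands (immediate_return t i) x" for x
    using i by (intro has_bochner_integral_cong refl immediate_return_indicator[symmetric])
  finally show ?thesis
    using i t by (simp only: prob_hold_event prob_win_event)
qed

section \<open>The bloc game\<close>

lemma beta_bloc:
  assumes "p \<in> {0..1}" "q \<in> {0..1}"
  shows "beta p q q = 2 - p - 2 * q + 2 * p * q\<^sup>2"
proof -
  have "has_bochner_integral hands (stakes_factor (thresholds p q q))
      (2 - (\<Sum>i\<in>players. thresholds p q q i) + 2 * (\<Prod>i\<in>players. thresholds p q q i))"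
    using assms by (intro has_bochner_integral_stakes_factor) (auto simp: thresholds_def)
  then show ?thesis
    by (simp add: beta_def has_bochner_integral_integral_eq players_def thresholds_def
        power2_eq_square)
qed

lemma integral_max_square:
  fixes p q :: real
  assumes "p \<in> {0..1}" "q \<in> {0..1}"
  shows "(\<integral>x. indicator {p..1} x * (max q x)\<^sup>2 \<partial>lborel)
    = (1 - (max p q) ^ 3) / 3 - q\<^sup>2 * (1 - max p q) + q\<^sup>2 * (1 - p)"
proof -
  let ?m = "max p q"
  have 1: "has_bochner_integral lborel (\<lambda>x. (x\<^sup>2 - q\<^sup>2) * indicator {?m..1} x)
      ((1 ^ 3 / 3 - q\<^sup>2 * 1) - (?m ^ 3 / 3 - q\<^sup>2 * ?m))"
    using assms by (intro has_bochner_integral_FTC_Icc_real)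
      (auto intro!: derivative_eq_intros continuous_intros)
  have 2: "has_bochner_integral lborel (\<lambda>x. q\<^sup>2 * indicator {p..1} x) (q\<^sup>2 * (1 - p))"
    using assms has_bochner_integral_mult_right[OF
        has_bochner_integral_real_indicator[of "{p..1}" lborel], of "q\<^sup>2"] by simp
  \<comment> \<open>Splitting off the constant \<open>q\<^sup>2\<close> leaves \<open>x\<^sup>2 - q\<^sup>2\<close> on the part above \<open>q\<close>, so that the cases
    \<open>p \<le> q\<close> and \<open>q \<le> p\<close> need no separate treatment.\<close>
  have "(\<lambda>x. indicator {p..1} x * (max q x)\<^sup>2)
      = (\<lambda>x. (x\<^sup>2 - q\<^sup>2) * indicator {?m..1} x + q\<^sup>2 * indicator {p..1} x)"
    by (auto simp: indicator_def max_def fun_eq_iff)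
  then show ?thesis
    using has_bochner_integral_integral_eq[OF has_bochner_integral_add[OF 1 2]]
    by (simp add: algebra_simps diff_divide_distrib)
qed

lemma alpha_bloc:
  assumes "p \<in> {0..1}" "q \<in> {0..1}"
  shows "alpha p q q = (if q \<le> p then 2 * (p - q) * (1 - p * (p + q))
    else (q - p) * (4 * q\<^sup>2 - 2))"
proof -
  have P: "players - {1} = {2, 3}" by (auto simp: players_def)
  have "has_bochner_integral hands (immediate_return (thresholds p q q) 1)
    (2 - (\<Sum>i\<in>players. thresholds p q q i) + 2 * (\<Prod>i\<in>players. thresholds p q q i) - 1
      + 6 * (\<integral>x. indicator {thresholds p q q 1..1} x
          * (\<Prod>j\<in>players - {1}. max (thresholds p q q j) x) \<partial>lborel)
      - 3 * (1 - thresholds p q q 1))"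
    using assms by (intro has_bochner_integral_immediate_return)
      (auto simp: thresholds_def players_def)
  then have "alpha p q q = 2 - (\<Sum>i\<in>players. thresholds p q q i)
      + 2 * (\<Prod>i\<in>players. thresholds p q q i) - 1
      + 6 * (\<integral>x. indicator {thresholds p q q 1..1} x
          * (\<Prod>j\<in>players - {1}. max (thresholds p q q j) x) \<partial>lborel)
      - 3 * (1 - thresholds p q q 1)"
    unfolding alpha_def by (rule has_bochner_integral_integral_eq)
  also have "\<dots> = 2 - (p + 2 * q) + 2 * p * q\<^sup>2 - 1
      + 6 * (\<integral>x. indicator {p..1} x * (max q x)\<^sup>2 \<partial>lborel) - 3 * (1 - p)"
    by (simp add: thresholds_def players_def P[unfolded players_def] power2_eq_square)
  also have "\<dots> = (if q \<le> p then 2 * (p - q) * (1 - p * (p + q))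
      else (q - p) * (4 * q\<^sup>2 - 2))"
    unfolding integral_max_square[OF assms]
    by (simp add: max_def field_simps power2_eq_square power3_eq_cube)
  finally show ?thesis .
qed

text \<open>The common threshold at the saddle point of \<open>alpha p q q\<close>.\<close>
definition crit :: real where
  "crit = 1 / sqrt 2"

lemma crit_square: "crit * crit = 1 / 2"
  by (simp add: crit_def)

lemma crit_bounds: "0 < crit" "1 / 2 < crit" "crit < 1"
proof -
  show pos: "0 < crit" by (simp add: crit_def)
  show "1 / 2 < crit"
    using pos crit_square mult_mono[of crit "1/2" crit "1/2"] by (force simp: not_less)
  show "crit < 1"
    using pos crit_square mult_mono[of 1 crit 1 crit] by (force simp: not_less)
qed

lemma crit_in_unit: "crit \<in> {0..1}"
  using crit_bounds by simp

lemma alpha_crit_above: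
  assumes "q \<in> {0..1}" "crit \<le> q"
  shows "alpha crit q q = 4 * (q - crit)\<^sup>2 * (q + crit)"
proof -
  have "alpha crit q q = (q - crit) * (4 * q\<^sup>2 - 4 * (crit * crit))"
    using assms crit_in_unit by (auto simp: alpha_bloc crit_square)
  then show ?thesis by (simp add: power2_eq_square algebra_simps)
qed

lemma alpha_crit_below:
  assumes "q \<in> {0..1}" "q \<le> crit"
  shows "alpha crit q q = 2 * crit * (q - crit)\<^sup>2"
proof -
  have "alpha crit q q = 2 * (crit - q) * (2 * (crit * crit) - crit * (crit + q))"
    using assms crit_in_unit by (simp only: alpha_bloc crit_square) simp
  then show ?thesis by (simp add: power2_eq_square algebra_simps)
qed

text \<open>Above \<open>crit\<close> the bound is far from sharp. Its right size is dictated by \<open>beta_crit\<close>: the same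
  quadratic term is what the stakes factor gains when the bloc deviates.\<close>
lemma alpha_crit_ge:
  assumes "q \<in> {0..1}"
  shows "2 * crit * (q - crit)\<^sup>2 \<le> alpha crit q q"
proof (cases "q \<le> crit")
  case False
  have "(2 * crit) * (q - crit)\<^sup>2 \<le> (4 * (q + crit)) * (q - crit)\<^sup>2"
    using False crit_bounds by (intro mult_right_mono) auto
  then show ?thesis
    using False assms by (simp add: alpha_crit_above mult_ac)
qed (use assms in \<open>simp add: alpha_crit_below\<close>)

lemma beta_crit:
  assumes "q \<in> {0..1}"
  shows "beta crit q q = (2 - 2 * crit) + 2 * crit * (q - crit)\<^sup>2"
proof -
  have "2 * crit * (q - crit)\<^sup>2 = 2 * crit * q\<^sup>2 - 4 * (crit * crit) * q + 2 * (crit * crit) * crit"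
    by (simp add: power2_eq_square algebra_simps)
  then show ?thesis
    using assms crit_in_unit by (simp add: beta_bloc crit_square)
qed

text \<open>Below \<open>crit\<close> player 1 is indifferent, since the factor \<open>4 q\<^sup>2 - 2\<close> vanishes at \<open>q = crit\<close>.
  Above, the factor \<open>1 - p (p + crit)\<close> changes sign exactly at \<open>p = crit\<close>.\<close>
lemma alpha_against_crit:
  assumes "p \<in> {0..1}"
  shows "alpha p crit crit \<le> 0"
proof (cases "crit \<le> p")
  case True
  then have "crit * (crit + crit) \<le> p * (p + crit)"
    using crit_bounds by (intro mult_mono) auto
  moreover have "crit * (crit + crit) = 1"
    by (simp only: distrib_left crit_square)
  ultimately have "1 \<le> p * (p + crit)" by simp
  then have "2 * (p - crit) * (1 - p * (p + crit)) \<le> 0"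
    using True by (intro mult_nonneg_nonpos) auto
  then show ?thesis
    using True assms crit_in_unit by (simp add: alpha_bloc)
next
  case False
  then show ?thesis
    using assms crit_in_unit by (simp add: alpha_bloc power2_eq_square crit_square)
qed

lemma beta_against_crit:
  assumes "p \<in> {0..1}"
  shows "beta p crit crit = 2 - 2 * crit"
  using assms crit_in_unit by (simp add: beta_bloc power2_eq_square crit_square)

section \<open>Bounds and measurability\<close>

lemma card_holders_le: "card (holders t h) \<le> 3"
proof -
  have "card (holders t h) \<le> card players"
    by (intro card_mono) (auto simp: holders_def)
  then show ?thesis by (simp add: players_def)
qed

lemma stakes_factor_bounds: "0 \<le> stakes_factor t h" "stakes_factor t h \<le> 2"
  using card_holders_le[of t h] by (auto simp: stakes_factor_def Let_def)

lemma abs_immediate_return_le: "\<bar>immediate_return t i h\<bar> \<le> 4"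
  using card_holders_le[of t h] by (auto simp: immediate_return_def Let_def abs_le_iff)

lemma (in prob_space) abs_integral_le_const:
  fixes f :: "'a \<Rightarrow> real"
  assumes "AE x in M. \<bar>f x\<bar> \<le> B" "0 \<le> B"
  shows "\<bar>\<integral>x. f x \<partial>M\<bar> \<le> B"
proof (cases "integrable M f")
  case True
  have "\<bar>\<integral>x. f x \<partial>M\<bar> \<le> (\<integral>x. \<bar>f x\<bar> \<partial>M)"
    using integral_norm_bound[of M f] by simp
  also have "\<dots> \<le> (\<integral>x. B \<partial>M)"
    using True assms by (intro integral_mono_AE) auto
  finally show ?thesis by (simp add: prob_space)
qed (use assms in \<open>simp add: not_integrable_integral_eq\<close>)

lemma abs_alpha_le: "\<bar>alpha p q r\<bar> \<le> 4"
  unfolding alpha_def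
  by (intro prob_space.abs_integral_le_const[OF prob_space_hands] AE_I2 abs_immediate_return_le) simp

lemma beta_nonneg: "0 \<le> beta p q r"
  unfolding beta_def by (intro integral_nonneg_AE AE_I2 stakes_factor_bounds)

lemma abs_beta_le: "\<bar>beta p q r\<bar> \<le> 2"
  unfolding beta_def
  by (intro prob_space.abs_integral_le_const[OF prob_space_hands] AE_I2)
    (simp_all add: abs_le_iff stakes_factor_bounds order_trans[OF _ stakes_factor_bounds(1)])

text \<open>A real infimum or supremum compares with a single reply only over a bounded set of values, which
  these uniform bounds provide.\<close>
lemma abs_alpha_beta_le: "\<bar>alpha p q r + beta p q r * w\<bar> \<le> 4 + 2 * \<bar>w\<bar>"
  using abs_alpha_le[of p q r] mult_right_mono[OF abs_beta_le[of p q r], of "\<bar>w\<bar>"]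
  by (simp add: abs_mult[symmetric] abs_triangle_ineq[THEN order_trans])

text \<open>The Bochner integral against a point mass is evaluation only for measurable integrands. Hence the
  values of pure strategies require \<open>alpha\<close> and \<open>beta\<close> to depend measurably on the thresholds, and
  this comes from joint measurability of the payoffs in thresholds and hands.\<close>
lemma measurable_indicator_dependent_events:
  assumes T: "\<And>i. i \<in> players \<Longrightarrow> (\<lambda>x. T x i) \<in> borel_measurable N" and i: "i \<in> players"
  shows "(\<lambda>z. indicator (hold_event (T (fst z)) i) (snd z) :: real) \<in> borel_measurable (N \<Otimes>\<^sub>M hands)"
    and "(\<lambda>z. indicator (drop_event (T (fst z))) (snd z) :: real) \<in> borel_measurable (N \<Otimes>\<^sub>M hands)"
    and "(\<lambda>z. indicator (win_event (T (fst z)) i) (snd z) :: real) \<in> borel_measurable (N \<Otimes>\<^sub>M hands)"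
proof -
  let ?P = "N \<Otimes>\<^sub>M hands"
  have T': "(\<lambda>z. T (fst z) j) \<in> borel_measurable ?P" if "j \<in> players" for j
    using measurable_compose[OF measurable_fst T[OF that]] .
  have h: "(\<lambda>z. snd z j) \<in> borel_measurable ?P" if "j \<in> players" for j
    using measurable_compose[OF measurable_snd measurable_hands_component[OF that]] .
  have [measurable]: "Measurable.pred ?P (\<lambda>z. T (fst z) j \<le> snd z j)"
    "Measurable.pred ?P (\<lambda>z. snd z j < T (fst z) j)"
    "Measurable.pred ?P (\<lambda>z. snd z j \<le> snd z i)" if "j \<in> players" for j
    unfolding pred_def
    by (intro borel_measurable_le borel_measurable_less T' h that i)+
  have "{z \<in> space ?P. T (fst z) i \<le> snd z i} \<in> sets ?P"
    "{z \<in> space ?P. \<forall>j\<in>players. snd z j < T (fst z) j} \<in> sets ?P"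
    "{z \<in> space ?P. T (fst z) i \<le> snd z i
      \<and> (\<forall>j\<in>players. snd z j < T (fst z) j \<or> snd z j \<le> snd z i)} \<in> sets ?P"
    using i by measurable
  note events = this[THEN borel_measurable_indicator, where 'b = real]
  show "(\<lambda>z. indicator (hold_event (T (fst z)) i) (snd z) :: real) \<in> borel_measurable ?P"
    by (rule measurable_cong[THEN iffD1, OF _ events(1)])
      (auto simp: hold_event_def indicator_def space_pair_measure)
  show "(\<lambda>z. indicator (drop_event (T (fst z))) (snd z) :: real) \<in> borel_measurable ?P"
    by (rule measurable_cong[THEN iffD1, OF _ events(2)])
      (auto simp: drop_event_def indicator_def space_pair_measure)
  show "(\<lambda>z. indicator (win_event (T (fst z)) i) (snd z) :: real) \<in> borel_measurable ?P"
    by (rule measurable_cong[THEN iffD1, OF _ events(3)])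
      (auto simp: win_event_def indicator_def space_pair_measure)
qed

lemma measurable_expected_stakes_and_return:
  assumes T: "\<And>i. i \<in> players \<Longrightarrow> (\<lambda>x. T x i) \<in> borel_measurable N" and i: "i \<in> players"
  shows "(\<lambda>x. \<integral>h. stakes_factor (T x) h \<partial>hands) \<in> borel_measurable N"
    and "(\<lambda>x. \<integral>h. immediate_return (T x) i h \<partial>hands) \<in> borel_measurable N"
proof -
  interpret H: prob_space hands by (rule prob_space_hands)
  let ?P = "N \<Otimes>\<^sub>M hands"
  note events = measurable_indicator_dependent_events[OF T]
  have "(\<lambda>z. (\<Sum>i\<in>players. indicator (hold_event (T (fst z)) i) (snd z)) - 1
      + 2 * indicator (drop_event (T (fst z))) (snd z) :: real) \<in> borel_measurable ?P"
    using i by (intro borel_measurable_add borel_measurable_diff borel_measurable_sum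
        borel_measurable_times borel_measurable_const events)
  then have S: "(\<lambda>z. stakes_factor (T (fst z)) (snd z)) \<in> borel_measurable ?P"
    by (rule measurable_cong[THEN iffD2, rotated])
      (auto simp: space_pair_measure stakes_factor_indicator)
  then have "(\<lambda>z. stakes_factor (T (fst z)) (snd z) - 1
      + 6 * indicator (win_event (T (fst z)) i) (snd z)
      - 3 * indicator (hold_event (T (fst z)) i) (snd z)) \<in> borel_measurable ?P"
    using i by (intro borel_measurable_add borel_measurable_diff
        borel_measurable_times borel_measurable_const events)
  then have R: "(\<lambda>z. immediate_return (T (fst z)) i (snd z)) \<in> borel_measurable ?P"
    by (rule measurable_cong[THEN iffD2, rotated])
      (use i in \<open>auto simp: space_pair_measure immediate_return_indicator\<close>)
  show "(\<lambda>x. \<integral>h. stakes_factor (T x) h \<partial>hands) \<in> borel_measurable N"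
    "(\<lambda>x. \<integral>h. immediate_return (T x) i h \<partial>hands) \<in> borel_measurable N"
    using S R by (auto intro!: H.borel_measurable_lebesgue_integral simp: split_beta')
qed

lemma measurable_alpha_beta [measurable]:
  assumes [measurable]: "f \<in> borel_measurable N" "g \<in> borel_measurable N" "k \<in> borel_measurable N"
  shows "(\<lambda>x. alpha (f x) (g x) (k x)) \<in> borel_measurable N"
    and "(\<lambda>x. beta (f x) (g x) (k x)) \<in> borel_measurable N"
proof -
  have "(\<lambda>x. thresholds (f x) (g x) (k x) i) \<in> borel_measurable N" for i
    unfolding thresholds_def by measurable
  then show "(\<lambda>x. alpha (f x) (g x) (k x)) \<in> borel_measurable N"
    "(\<lambda>x. beta (f x) (g x) (k x)) \<in> borel_measurable N"
    unfolding alpha_def beta_def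
    by (intro measurable_expected_stakes_and_return[where i = 1]; simp add: players_def)+
qed

section \<open>Guarantees\<close>

lemma mixed_strategy_AE:
  assumes "mixed_strategy \<mu>"
  shows "AE p in \<mu>. p \<in> {0..1}"
proof -
  interpret prob_space \<mu> using assms by (simp add: mixed_strategy_def)
  show ?thesis
    using assms by (intro AE_prob_1) (simp add: mixed_strategy_def measure_def)
qed

lemma strategy_sequence_repeated_pure:
  "p \<in> {0..1} \<Longrightarrow> strategy_sequence (repeated (pure p))"
  by (simp add: strategy_sequence_def repeated_def pure_def mixed_strategy_def
      prob_space_return)

lemma integral_pure: "f \<in> borel_measurable borel \<Longrightarrow> (\<integral>x. f x \<partial>pure p) = (f p :: real)"
  by (simp add: pure_def integral_return)

text \<open>The bloc can answer every strategy of player 1 with \<open>crit\<close>: the round then returns nothing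
  positive, and the nonnegative stakes factor preserves the sign of what follows.\<close>
lemma worst_return_nonpos:
  assumes "strategy_sequence S"
  shows "worst_return S m k \<le> 0"
proof (induction m arbitrary: k)
  case (Suc m)
  let ?w = "worst_return S m (Suc k)"
  let ?v = "\<lambda>q. alpha_mixed (S k) q q + beta_mixed (S k) q q * ?w"
  have mixed: "mixed_strategy (S k)"
    using assms by (simp add: strategy_sequence_def)
  interpret prob_space "S k"
    using mixed by (simp add: mixed_strategy_def)
  have a: "\<bar>alpha_mixed (S k) q q\<bar> \<le> 4" for q
    unfolding alpha_mixed_def by (intro abs_integral_le_const) (simp_all add: abs_alpha_le)
  have b: "\<bar>beta_mixed (S k) q q\<bar> \<le> 2" for q
    unfolding beta_mixed_def by (intro abs_integral_le_const) (simp_all add: abs_beta_le)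
  have "- (4 + 2 * \<bar>?w\<bar>) \<le> ?v q" for q
    using a[of q] mult_right_mono[OF b[of q], of "\<bar>?w\<bar>"] by (simp add: abs_mult[symmetric])
  then have bdd: "bdd_below (?v ` {0..1})"
    by (intro bdd_belowI2)
  have "AE p in S k. 0 \<le> - alpha p crit crit"
    using mixed_strategy_AE[OF mixed] by eventually_elim (simp add: alpha_against_crit)
  then have "alpha_mixed (S k) crit crit \<le> 0"
    unfolding alpha_mixed_def using integral_nonneg_AE by fastforce
  moreover have "0 \<le> beta_mixed (S k) crit crit"
    unfolding beta_mixed_def by (intro integral_nonneg_AE AE_I2 beta_nonneg)
  ultimately have "?v crit \<le> 0"
    using Suc.IH[of "Suc k"] by (simp add: add_nonpos_nonpos mult_nonneg_nonpos)
  then show ?case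
    using cINF_lower2[OF bdd crit_in_unit] by simp
qed simp

text \<open>The mirror image, with \<open>crit\<close> as player 1's answer.\<close>
lemma best_return_nonneg:
  assumes "strategy_sequence Q"
  shows "0 \<le> best_return Q m k"
proof (induction m arbitrary: k)
  case (Suc m)
  let ?w = "best_return Q m (Suc k)"
  let ?v = "\<lambda>p. \<integral>q. alpha p q q + beta p q q * ?w \<partial>(Q k)"
  have mixed: "mixed_strategy (Q k)"
    using assms by (simp add: strategy_sequence_def)
  interpret prob_space "Q k"
    using mixed by (simp add: mixed_strategy_def)
  have "\<bar>?v p\<bar> \<le> 4 + 2 * \<bar>?w\<bar>" for p
    by (intro abs_integral_le_const AE_I2 abs_alpha_beta_le) simp
  then have bdd: "bdd_above (?v ` {0..1})"
    by (intro bdd_aboveI2) (auto simp: abs_le_iff)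
  have "AE q in Q k. 0 \<le> alpha crit q q + beta crit q q * ?w"
    using mixed_strategy_AE[OF mixed]
  proof eventually_elim
    case (elim q)
    have "0 \<le> 2 * crit * (q - crit)\<^sup>2"
      using crit_bounds by simp
    then have "0 \<le> alpha crit q q"
      using alpha_crit_ge[OF elim] by linarith
    then show ?case
      using Suc.IH[of "Suc k"] beta_nonneg by simp
  qed
  then have "0 \<le> ?v crit"
    by (rule integral_nonneg_AE)
  then show ?case
    using cSUP_upper2[OF bdd crit_in_unit] by simp
qed simp

text \<open>Let \<open>\<kappa> = 2 - 2 crit\<close> and \<open>d = 2 crit (q - crit)\<^sup>2\<close>. With continuation value at least
  \<open>- (\<kappa> ^ m)\<close> the round is worth at least
  \<open>d - (\<kappa> + d) \<kappa> ^ m = d (1 - \<kappa> ^ m) - \<kappa> ^ Suc m\<close>, and \<open>\<kappa> ^ m \<le> 1\<close>.\<close>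
lemma worst_return_crit:
  "- ((2 - 2 * crit) ^ m) \<le> worst_return (repeated (pure crit)) m k"
proof (induction m arbitrary: k)
  case (Suc m)
  let ?c = "2 - 2 * crit"
  let ?w = "worst_return (repeated (pure crit)) m (Suc k)"
  have "- (?c ^ Suc m) \<le> alpha crit q q + beta crit q q * ?w" if q: "q \<in> {0..1}" for q
  proof -
    have "?c ^ m \<le> 1"
      using crit_bounds by (intro power_le_one) auto
    then have "0 \<le> (2 * crit * (q - crit)\<^sup>2) * (1 - ?c ^ m)"
      using crit_bounds by simp
    then have "- (?c ^ Suc m) \<le> 2 * crit * (q - crit)\<^sup>2 + beta crit q q * (- (?c ^ m))"
      unfolding beta_crit[OF q] by (simp add: algebra_simps)
    also have "\<dots> \<le> alpha crit q q + beta crit q q * ?w"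
      using q Suc.IH by (intro add_mono mult_left_mono alpha_crit_ge beta_nonneg)
    finally show ?thesis .
  qed
  then show ?case
    by (auto intro!: cINF_greatest
        simp: repeated_def alpha_mixed_def beta_mixed_def integral_pure simp del: power_Suc)
qed simp

lemma best_return_crit:
  "best_return (repeated (pure crit)) m k \<le> (2 - 2 * crit) ^ m"
proof (induction m arbitrary: k)
  case (Suc m)
  let ?c = "2 - 2 * crit"
  let ?w = "best_return (repeated (pure crit)) m (Suc k)"
  have "alpha p crit crit + beta p crit crit * ?w \<le> ?c ^ Suc m" if p: "p \<in> {0..1}" for p
  proof -
    have "?c * ?w \<le> ?c * ?c ^ m"
      using crit_bounds Suc.IH by (intro mult_left_mono) auto
    then show ?thesis
      using alpha_against_crit[OF p] beta_against_crit[OF p] by simp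
  qed
  then show ?case
    by (auto intro!: cSUP_least simp: repeated_def integral_pure simp del: power_Suc)
qed simp

lemma crit_power_tendsto: "(\<lambda>n. (2 - 2 * crit) ^ n) \<longlonglongrightarrow> 0"
  using crit_bounds by (intro LIMSEQ_realpow_zero) auto

lemma guarantees_at_least_crit: "guarantees_at_least (repeated (pure crit)) 0"
  unfolding guarantees_at_least_def
proof (rule tendsto_upperbound)
  show "(\<lambda>n. ereal (- ((2 - 2 * crit) ^ n))) \<longlonglongrightarrow> ereal 0"
    using tendsto_minus[OF crit_power_tendsto] by simp
  show "\<forall>\<^sub>F n in sequentially. ereal (- ((2 - 2 * crit) ^ n))
      \<le> (SUP n\<in>{1..}. ereal (player1_value n (repeated (pure crit))))"
    using eventually_ge_at_top[of 1]
    by eventually_elim (rule SUP_upper2, auto simp: player1_value_def intro: worst_return_crit)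
qed simp

lemma guarantees_at_most_crit: "guarantees_at_most (repeated (pure crit)) 0"
  unfolding guarantees_at_most_def
proof (rule tendsto_lowerbound)
  show "(\<lambda>n. ereal ((2 - 2 * crit) ^ n)) \<longlonglongrightarrow> ereal 0"
    using crit_power_tendsto by simp
  show "\<forall>\<^sub>F n in sequentially. (INF n\<in>{1..}. ereal (bloc_value n (repeated (pure crit))))
      \<le> ereal ((2 - 2 * crit) ^ n)"
    using eventually_ge_at_top[of 1]
    by eventually_elim (rule INF_lower2, auto simp: bloc_value_def intro: best_return_crit)
qed simp

lemma guarantees_at_least_nonpos:
  assumes "strategy_sequence S" "guarantees_at_least S c"
  shows "c \<le> 0"
proof -
  have "ereal c \<le> (SUP n\<in>{1..}. ereal (player1_value n S))"
    using assms by (simp add: guarantees_at_least_def)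
  also have "\<dots> \<le> ereal 0"
    using assms by (intro SUP_least) (simp add: player1_value_def worst_return_nonpos)
  finally show ?thesis by simp
qed

lemma guarantees_at_most_nonneg:
  assumes "strategy_sequence Q" "guarantees_at_most Q c"
  shows "0 \<le> c"
proof -
  have "ereal 0 \<le> (INF n\<in>{1..}. ereal (bloc_value n Q))"
    using assms by (intro INF_greatest) (simp add: bloc_value_def best_return_nonneg)
  also have "\<dots> \<le> ereal c"
    using assms by (simp add: guarantees_at_most_def)
  finally show ?thesis by simp
qed

lemma optimal_player1_crit: "optimal_player1 (repeated (pure crit))"
  using guarantees_at_least_crit guarantees_at_least_nonpos strategy_sequence_repeated_pure
    crit_in_unit
  unfolding optimal_player1_def guarantees_at_least_def
  by (meson ereal_less_eq(3) order_trans)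

lemma optimal_bloc_crit: "optimal_bloc (repeated (pure crit))"
  using guarantees_at_most_crit guarantees_at_most_nonneg strategy_sequence_repeated_pure
    crit_in_unit
  unfolding optimal_bloc_def guarantees_at_most_def
  by (meson ereal_less_eq(3) order_trans)

theorem proposition6p5:
  shows "optimal_player1 (repeated (pure (1 / sqrt 2)))
    \<and> guarantees_at_least (repeated (pure (1 / sqrt 2))) 0
    \<and> (\<forall>q\<in>{0..1}. q \<ge> 1 / sqrt 2 \<longrightarrow>
          alpha (1 / sqrt 2) q q \<ge> 4 * (q - 1 / sqrt 2)\<^sup>2 * (q + 1 / sqrt 2))
    \<and> (\<forall>q\<in>{0..1}. q \<le> 1 / sqrt 2 \<longrightarrow>
          alpha (1 / sqrt 2) q q \<ge> 2 * (q - 1 / sqrt 2)\<^sup>2 / sqrt 2)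
    \<and> optimal_bloc (repeated (pure (1 / sqrt 2)))
    \<and> guarantees_at_most (repeated (pure (1 / sqrt 2))) 0"
proof -
  have "2 * x / sqrt 2 = 2 * crit * x" for x
    by (simp add: crit_def)
  then show ?thesis
    unfolding crit_def[symmetric]
    using optimal_player1_crit guarantees_at_least_crit optimal_bloc_crit guarantees_at_most_crit
    by (simp add: alpha_crit_above alpha_crit_below)
qed

end
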